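(* The sum $L$ of a modular connected system is locally finite.
   Context: A lattice is l.f.f.c. if every closed interval is finite and every element has finitely many upper covers and finitely many lower covers. $x\lessdot y$ means $y$ covers $x$. A tolerance on a lattice $S$ is a reflexive, symmetric relation $\gamma$ with $a\,\gamma\,b$, $c\,\gamma\,d$ implying $(a\vee c)\,\gamma\,(b\vee d)$ and $(a\wedge c)\,\gamma\,(b\wedge d)$; $x\le_\gamma y$ means $x\le y$ and $x\,\gamma\,y$. A modular connected system $(S,\gamma,(L_x)_{x\in S},(\varphi_x^y)_{x\le_\gamma y})$ is a lattice $S$, a tolerance $\gamma$ on $S$, lattices $L_x$ and maps $\varphi_x^y$ satisfying: (MC1) $S$ is l.f.f.c.; (MC2) each $L_x$ is finite, modular, complemented; (MC3) each $\varphi_x^y$ is a lattice isomorphism from a nonempty lattice filter $F_x^y$ of $L_x$ onto a lattice ideal $I_x^y$ of $L_y$; (MC4) $F_x^x=I_x^x=L_x$, $\varphi_x^x=\mathrm{id}$; (MC5) if $x\le_\gamma y\le_\gamma z$ and $I_x^y\cap F_y^z\neq\emptyset$ then $x\,\gamma\,z$; (MC6) for $x\le z\le y$ with $x\,\gamma\,y$: $F_x^y=(\varphi_x^z)^{-1}(I_x^z\cap F_z^y)$, $I_x^y=\varphi_z^y(I_x^z\cap F_z^y)$, $\varphi_x^y=\varphi_z^y\circ\varphi_x^z|_{F_x^y}$; (MC7) if $x\,\gamma\,y$ then $I_x^{x\vee y}\cap I_y^{x\vee y}\subseteq I_{x\wedge y}^{x\vee y}$ and $F_{x\wedge y}^x\cap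 F_{x\wedge y}^y\subseteq F_{x\wedge y}^{x\vee y}$; (MC8.1) $x\lessdot y$ implies $x\,\gamma\,y$; (MC8.2) $x\lessdot y$ implies $F_x^y\neq L_x$ and $I_x^y\neq L_y$. Sum: $M=\{(x,a):x\in S,a\in L_x\}$, $(x,a)\sim(y,b)$ iff $x\,\gamma\,y$, $a\in F_x^{x\vee y}$, $b\in F_y^{x\vee y}$, $\varphi_x^{x\vee y}(a)=\varphi_y^{x\vee y}(b)$ (an equivalence relation); $L=M/{\sim}$; $\pi_x(a)$ is the class of $(x,a)$, $\Lambda_x=\pi_x(L_x)$. For $v\in S$, $a\le_v b$ iff $a,b\in\Lambda_v$ and $\pi_v^{-1}a\le\pi_v^{-1}b$ in $L_v$. $L$ is partially ordered by $a\le b$ iff there exist $n\ge0$, $x_1\le\dots\le x_n$ in $S$ and $a=a_0\le_{x_1}a_1\le_{x_2}\cdots\le_{x_n}a_n=b$. Locally finite means every interval $[a,b]$ of $L$ is finite. *)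

theory Defs
  imports "HOL-Algebra.Lattice"
begin

section \<open>Lattice-theoretic notions\<close>

definition covered_by :: "'a gorder \<Rightarrow> 'a \<Rightarrow> 'a \<Rightarrow> bool" where
  "covered_by P x y \<longleftrightarrow> x \<in> carrier P \<and> y \<in> carrier P \<and> x \<sqsubset>\<^bsub>P\<^esub> y \<and>
     \<not> (\<exists>z\<in>carrier P. x \<sqsubset>\<^bsub>P\<^esub> z \<and> z \<sqsubset>\<^bsub>P\<^esub> y)"

definition locally_finite :: "'a gorder \<Rightarrow> bool" where
  "locally_finite P \<longleftrightarrow> (\<forall>a\<in>carrier P. \<forall>b\<in>carrier P. finite \<lbrace>a..b\<rbrace>\<^bsub>P\<^esub>)"

text \<open>``Locally finite with finite covers''.\<close>
definition lffc :: "'a gorder \<Rightarrow> bool" where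
  "lffc P \<longleftrightarrow> locally_finite P \<and>
     (\<forall>x\<in>carrier P. finite {y. covered_by P x y} \<and> finite {y. covered_by P y x})"

definition modular_lattice :: "'a gorder \<Rightarrow> bool" where
  "modular_lattice L \<longleftrightarrow> lattice L \<and>
     (\<forall>a\<in>carrier L. \<forall>b\<in>carrier L. \<forall>c\<in>carrier L. a \<sqsubseteq>\<^bsub>L\<^esub> c \<longrightarrow>
        a \<squnion>\<^bsub>L\<^esub> (b \<sqinter>\<^bsub>L\<^esub> c) = (a \<squnion>\<^bsub>L\<^esub> b) \<sqinter>\<^bsub>L\<^esub> c)"

definition complemented_lattice :: "'a gorder \<Rightarrow> bool" where
  "complemented_lattice L \<longleftrightarrow> bounded_lattice L \<and>
     (\<forall>a\<in>carrier L. \<exists>b\<in>carrier L. a \<squnion>\<^bsub>L\<^esub> b = \<top>\<^bsub>L\<^esub> \<and> a \<sqinter>\<^bsub>L\<^esub> b = \<bottom>\<^bsub>L\<^esub>)"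

definition lattice_filter :: "'a gorder \<Rightarrow> 'a set \<Rightarrow> bool" where
  "lattice_filter L F \<longleftrightarrow> F \<subseteq> carrier L \<and>
     (\<forall>a\<in>F. \<forall>b\<in>carrier L. a \<sqsubseteq>\<^bsub>L\<^esub> b \<longrightarrow> b \<in> F) \<and>
     (\<forall>a\<in>F. \<forall>b\<in>F. a \<sqinter>\<^bsub>L\<^esub> b \<in> F)"

definition lattice_ideal :: "'a gorder \<Rightarrow> 'a set \<Rightarrow> bool" where
  "lattice_ideal L I \<longleftrightarrow> I \<subseteq> carrier L \<and>
     (\<forall>a\<in>I. \<forall>b\<in>carrier L. b \<sqsubseteq>\<^bsub>L\<^esub> a \<longrightarrow> b \<in> I) \<and>
     (\<forall>a\<in>I. \<forall>b\<in>I. a \<squnion>\<^bsub>L\<^esub> b \<in> I)"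

text \<open>Lattice isomorphism from a sublattice \<open>A\<close> of \<open>K\<close> onto a sublattice \<open>B\<close> of \<open>L\<close>;
  joins and meets in a sublattice are those of the ambient lattice.\<close>
definition lattice_iso_on ::
    "'a gorder \<Rightarrow> 'a set \<Rightarrow> 'b gorder \<Rightarrow> 'b set \<Rightarrow> ('a \<Rightarrow> 'b) \<Rightarrow> bool" where
  "lattice_iso_on K A L B f \<longleftrightarrow> bij_betw f A B \<and>
     (\<forall>a\<in>A. \<forall>b\<in>A. f (a \<squnion>\<^bsub>K\<^esub> b) = f a \<squnion>\<^bsub>L\<^esub> f b \<and> f (a \<sqinter>\<^bsub>K\<^esub> b) = f a \<sqinter>\<^bsub>L\<^esub> f b)"

definition tolerance :: "'s gorder \<Rightarrow> ('s \<times> 's) set \<Rightarrow> bool" where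
  "tolerance S \<gamma> \<longleftrightarrow> \<gamma> \<subseteq> carrier S \<times> carrier S \<and> refl_on (carrier S) \<gamma> \<and> sym \<gamma> \<and>
     (\<forall>a b c d. (a, b) \<in> \<gamma> \<longrightarrow> (c, d) \<in> \<gamma> \<longrightarrow>
        (a \<squnion>\<^bsub>S\<^esub> c, b \<squnion>\<^bsub>S\<^esub> d) \<in> \<gamma> \<and> (a \<sqinter>\<^bsub>S\<^esub> c, b \<sqinter>\<^bsub>S\<^esub> d) \<in> \<gamma>)"

definition tol_le :: "'s gorder \<Rightarrow> ('s \<times> 's) set \<Rightarrow> 's \<Rightarrow> 's \<Rightarrow> bool" where
  "tol_le S \<gamma> x y \<longleftrightarrow> x \<sqsubseteq>\<^bsub>S\<^esub> y \<and> (x, y) \<in> \<gamma>"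


section \<open>Modular connected systems\<close>

text \<open>The blocks \<open>L x\<close> share one ambient type \<open>'a\<close> but are otherwise unrelated; their carriers
  may overlap.  The partial map with domain \<open>F x y\<close> and image \<open>I x y\<close> is represented by the
  total function \<open>\<phi> x y\<close>, whose values outside \<open>F x y\<close> are irrelevant, and
  \<open>F\<close>, \<open>I\<close>, \<open>\<phi>\<close> matter only at pairs with \<open>tol_le S \<gamma> x y\<close>.\<close>
locale modular_connected_system =
  fixes S :: "'s gorder"
    and \<gamma> :: "('s \<times> 's) set"
    and L :: "'s \<Rightarrow> 'a gorder"
    and F :: "'s \<Rightarrow> 's \<Rightarrow> 'a set"
    and I :: "'s \<Rightarrow> 's \<Rightarrow> 'a set"
    and \<phi> :: "'s \<Rightarrow> 's \<Rightarrow> 'a \<Rightarrow> 'a"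
  assumes lattice_S: "lattice S"
    and tolerance_S: "tolerance S \<gamma>"
    and MC1: "lffc S"
    and MC2: "x \<in> carrier S \<Longrightarrow>
        lattice (L x) \<and> finite (carrier (L x)) \<and> modular_lattice (L x) \<and> complemented_lattice (L x)"
    and MC3: "tol_le S \<gamma> x y \<Longrightarrow>
        F x y \<noteq> {} \<and> lattice_filter (L x) (F x y) \<and> lattice_ideal (L y) (I x y) \<and>
        lattice_iso_on (L x) (F x y) (L y) (I x y) (\<phi> x y)"
    and MC4: "x \<in> carrier S \<Longrightarrow>
        F x x = carrier (L x) \<and> I x x = carrier (L x) \<and> (\<forall>a\<in>carrier (L x). \<phi> x x a = a)"
    and MC5: "tol_le S \<gamma> x y \<Longrightarrow> tol_le S \<gamma> y z \<Longrightarrow> I x y \<inter> F y z \<noteq> {} \<Longrightarrow> (x, z) \<in> \<gamma>"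
    and MC6: "z \<in> carrier S \<Longrightarrow> x \<sqsubseteq>\<^bsub>S\<^esub> z \<Longrightarrow> z \<sqsubseteq>\<^bsub>S\<^esub> y \<Longrightarrow> (x, y) \<in> \<gamma> \<Longrightarrow>
        F x y = {a \<in> F x z. \<phi> x z a \<in> I x z \<inter> F z y} \<and>
        I x y = \<phi> z y ` (I x z \<inter> F z y) \<and>
        (\<forall>a\<in>F x y. \<phi> x y a = \<phi> z y (\<phi> x z a))"
    and MC7: "(x, y) \<in> \<gamma> \<Longrightarrow>
        I x (x \<squnion>\<^bsub>S\<^esub> y) \<inter> I y (x \<squnion>\<^bsub>S\<^esub> y) \<subseteq> I (x \<sqinter>\<^bsub>S\<^esub> y) (x \<squnion>\<^bsub>S\<^esub> y) \<and>
        F (x \<sqinter>\<^bsub>S\<^esub> y) x \<inter> F (x \<sqinter>\<^bsub>S\<^esub> y) y \<subseteq> F (x \<sqinter>\<^bsub>S\<^esub> y) (x \<squnion>\<^bsub>S\<^esub> y)"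
    and MC8_1: "covered_by S x y \<Longrightarrow> (x, y) \<in> \<gamma>"
    and MC8_2: "covered_by S x y \<Longrightarrow> F x y \<noteq> carrier (L x) \<and> I x y \<noteq> carrier (L y)"


section \<open>The sum of a modular connected system\<close>

definition mcs_points :: "'s gorder \<Rightarrow> ('s \<Rightarrow> 'a gorder) \<Rightarrow> ('s \<times> 'a) set" where
  "mcs_points S L = (SIGMA x : carrier S. carrier (L x))"

definition mcs_rel :: "'s gorder \<Rightarrow> ('s \<times> 's) set \<Rightarrow> ('s \<Rightarrow> 'a gorder) \<Rightarrow>
    ('s \<Rightarrow> 's \<Rightarrow> 'a set) \<Rightarrow> ('s \<Rightarrow> 's \<Rightarrow> 'a \<Rightarrow> 'a) \<Rightarrow> (('s \<times> 'a) \<times> ('s \<times> 'a)) set" where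
  "mcs_rel S \<gamma> L F \<phi> =
     {((x, a), (y, b)). (x, a) \<in> mcs_points S L \<and> (y, b) \<in> mcs_points S L \<and> (x, y) \<in> \<gamma> \<and>
        a \<in> F x (x \<squnion>\<^bsub>S\<^esub> y) \<and> b \<in> F y (x \<squnion>\<^bsub>S\<^esub> y) \<and>
        \<phi> x (x \<squnion>\<^bsub>S\<^esub> y) a = \<phi> y (x \<squnion>\<^bsub>S\<^esub> y) b}"

definition mcs_proj :: "'s gorder \<Rightarrow> ('s \<times> 's) set \<Rightarrow> ('s \<Rightarrow> 'a gorder) \<Rightarrow>
    ('s \<Rightarrow> 's \<Rightarrow> 'a set) \<Rightarrow> ('s \<Rightarrow> 's \<Rightarrow> 'a \<Rightarrow> 'a) \<Rightarrow> 's \<Rightarrow> 'a \<Rightarrow> ('s \<times> 'a) set" where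
  "mcs_proj S \<gamma> L F \<phi> x a = mcs_rel S \<gamma> L F \<phi> `` {(x, a)}"

definition mcs_block :: "'s gorder \<Rightarrow> ('s \<times> 's) set \<Rightarrow> ('s \<Rightarrow> 'a gorder) \<Rightarrow>
    ('s \<Rightarrow> 's \<Rightarrow> 'a set) \<Rightarrow> ('s \<Rightarrow> 's \<Rightarrow> 'a \<Rightarrow> 'a) \<Rightarrow> 's \<Rightarrow> ('s \<times> 'a) set set" where
  "mcs_block S \<gamma> L F \<phi> x = mcs_proj S \<gamma> L F \<phi> x ` carrier (L x)"

definition mcs_block_le :: "'s gorder \<Rightarrow> ('s \<times> 's) set \<Rightarrow> ('s \<Rightarrow> 'a gorder) \<Rightarrow>
    ('s \<Rightarrow> 's \<Rightarrow> 'a set) \<Rightarrow> ('s \<Rightarrow> 's \<Rightarrow> 'a \<Rightarrow> 'a) \<Rightarrow>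
    's \<Rightarrow> ('s \<times> 'a) set \<Rightarrow> ('s \<times> 'a) set \<Rightarrow> bool" where
  "mcs_block_le S \<gamma> L F \<phi> v a b \<longleftrightarrow>
     a \<in> mcs_block S \<gamma> L F \<phi> v \<and> b \<in> mcs_block S \<gamma> L F \<phi> v \<and>
     inv_into (carrier (L v)) (mcs_proj S \<gamma> L F \<phi> v) a \<sqsubseteq>\<^bsub>L v\<^esub>
     inv_into (carrier (L v)) (mcs_proj S \<gamma> L F \<phi> v) b"

text \<open>The order is given by chains \<open>c 0, \<dots>, c n\<close> whose \<open>i\<close>-th step lies in block \<open>x i\<close>
  (\<open>1 \<le> i \<le> n\<close>); the case \<open>n = 0\<close> gives reflexivity.\<close>
definition mcs_le :: "'s gorder \<Rightarrow> ('s \<times> 's) set \<Rightarrow> ('s \<Rightarrow> 'a gorder) \<Rightarrow>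
    ('s \<Rightarrow> 's \<Rightarrow> 'a set) \<Rightarrow> ('s \<Rightarrow> 's \<Rightarrow> 'a \<Rightarrow> 'a) \<Rightarrow>
    ('s \<times> 'a) set \<Rightarrow> ('s \<times> 'a) set \<Rightarrow> bool" where
  "mcs_le S \<gamma> L F \<phi> a b \<longleftrightarrow>
     (\<exists>(n::nat) (x :: nat \<Rightarrow> 's) (c :: nat \<Rightarrow> ('s \<times> 'a) set).
        c 0 = a \<and> c n = b \<and>
        (\<forall>i\<in>{1..n}. x i \<in> carrier S) \<and>
        (\<forall>i\<in>{1..<n}. x i \<sqsubseteq>\<^bsub>S\<^esub> x (i + 1)) \<and>
        (\<forall>i\<in>{1..n}. mcs_block_le S \<gamma> L F \<phi> (x i) (c (i - 1)) (c i)))"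

definition mcs_sum :: "'s gorder \<Rightarrow> ('s \<times> 's) set \<Rightarrow> ('s \<Rightarrow> 'a gorder) \<Rightarrow>
    ('s \<Rightarrow> 's \<Rightarrow> 'a set) \<Rightarrow> ('s \<Rightarrow> 's \<Rightarrow> 'a \<Rightarrow> 'a) \<Rightarrow> ('s \<times> 'a) set gorder" where
  "mcs_sum S \<gamma> L F \<phi> =
     \<lparr>carrier = mcs_points S L // mcs_rel S \<gamma> L F \<phi>, eq = (=), le = mcs_le S \<gamma> L F \<phi>\<rparr>"

end

theory Submission
  imports Defs
begin

text \<open>For an element \<open>c\<close> of the sum, consider its support, the set of all \<open>x\<close> in \<open>S\<close> whose block
  contains \<open>c\<close>. By (MC8.2) the filters \<open>F x y\<close> shrink strictly when \<open>y\<close> moves up a cover, and the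
  ideals \<open>I x y\<close> when \<open>x\<close> moves down one; since the blocks are finite and so are the sets of covers,
  every point of \<open>S\<close> is \<open>\<gamma>\<close>-related to finitely many points only, so supports are finite.
  If \<open>a \<le> b\<close> within the block at \<open>v\<close> and \<open>z\<close> is in the support of \<open>b\<close>, then the meet of \<open>v\<close> and \<open>z\<close>
  is in the support of \<open>b\<close> by (MC7), hence in that of \<open>a\<close> because the overlap of two comparable
  blocks is an ideal of the upper one; dually for joins. Following chains, each point of the support
  of some \<open>c\<close> in \<open>[a, b]\<close> lies above a point of the support of \<open>a\<close> and below a point of the support of
  \<open>b\<close>. So all such \<open>c\<close> lie in finitely many finite blocks.\<close>

section \<open>Finite descent and covers in locally finite orders\<close>

text \<open>Each step to \<open>z\<close> raises \<open>f\<close>, which is bounded by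
  \<open>N\<close>, so only \<open>x\<close> can have value \<open>N\<close>. Points with value at
  least \<open>N - k - 1\<close> are \<open>x\<close> or lie in one of the finitely many finite sets
  \<open>C z\<close> with \<open>f z\<close> at least \<open>N - k\<close>. The form
  \<open>N \<le> f y + k\<close> avoids truncated subtraction.\<close>

lemma finite_by_descent:
  fixes f :: "'b \<Rightarrow> nat"
  assumes step: "\<And>y. y \<in> U \<Longrightarrow> y \<noteq> x \<Longrightarrow> \<exists>z\<in>U. y \<in> C z \<and> f y < f z"
    and fin: "\<And>z. z \<in> U \<Longrightarrow> finite (C z)"
    and bound: "\<And>y. y \<in> U \<Longrightarrow> f y \<le> N"
  shows "finite U"
proof -
  have "finite {y \<in> U. N \<le> f y + k}" for k
  proof (induction k)
    case 0
    have "{y \<in> U. N \<le> f y + 0} \<subseteq> {x}"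
      using step bound by fastforce
    then show ?case by (rule finite_subset) simp
  next
    case (Suc k)
    have "{y \<in> U. N \<le> f y + Suc k} \<subseteq> insert x (\<Union>z\<in>{z \<in> U. N \<le> f z + k}. C z)"
    proof
      fix y
      assume y: "y \<in> {y \<in> U. N \<le> f y + Suc k}"
      show "y \<in> insert x (\<Union>z\<in>{z \<in> U. N \<le> f z + k}. C z)"
      proof (cases "y = x")
        case False
        then obtain z where "z \<in> U" "y \<in> C z" "f y < f z"
          using step y by blast
        moreover from this y have "N \<le> f z + k" by simp
        ultimately show ?thesis by blast
      qed simp
    qed
    moreover have "finite (insert x (\<Union>z\<in>{z \<in> U. N \<le> f z + k}. C z))"
      using Suc fin by auto
    ultimately show ?case by (rule finite_subset)
  qed
  from this[of N] show ?thesis by simp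
qed

lemma ex_covered_by_upper:
  fixes L :: "'b gorder" (structure)
  assumes "partial_order L" and lf: "locally_finite L" and x: "x \<in> carrier L" and y: "y \<in> carrier L" and less: "x \<sqsubset> y"
  obtains z where "x \<sqsubseteq> z" "covered_by L z y"
proof -
  interpret partial_order L by fact
  let ?A = "{z \<in> carrier L. x \<sqsubseteq> z \<and> z \<sqsubset> y}"
  let ?up = "\<lambda>z. {w \<in> ?A. z \<sqsubset> w}"
  have "?A \<subseteq> \<lbrace>x..y\<rbrace>"
    by (auto simp: at_least_at_most_def lless_eq)
  moreover have "finite \<lbrace>x..y\<rbrace>"
    using lf x y by (simp add: locally_finite_def)
  ultimately have fin: "finite ?A" by (rule finite_subset)
  have "x \<in> ?A" using x less by simp
  \<comment> \<open>A point with the fewest members of \<open>?A\<close> strictly above it is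
    maximal in \<open>?A\<close>: passing to a larger \<open>w\<close> removes \<open>w\<close>
    itself from the set counted.\<close>
  then obtain z where z: "z \<in> ?A" and min: "\<And>w. w \<in> ?A \<Longrightarrow> card (?up z) \<le> card (?up w)"
    using ex_has_least_nat[of "\<lambda>z. z \<in> ?A" x "\<lambda>z. card (?up z)"] by blast
  have "\<not> (\<exists>w\<in>carrier L. z \<sqsubset> w \<and> w \<sqsubset> y)"
  proof
    assume "\<exists>w\<in>carrier L. z \<sqsubset> w \<and> w \<sqsubset> y"
    then obtain w where w: "w \<in> carrier L" "z \<sqsubset> w" "w \<sqsubset> y" by blast
    have wA: "w \<in> ?A"
      using z w x by (auto simp: lless_eq intro: le_trans)
    have "?up w \<subset> ?up z"
    proof
      show "?up w \<subseteq> ?up z"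
        using z w lless_trans by blast
      have "w \<in> ?up z" "w \<notin> ?up w"
        using wA w by (auto simp: lless_eq)
      then show "?up w \<noteq> ?up z" by blast
    qed
    then have "card (?up w) < card (?up z)"
      by (rule psubset_card_mono[rotated]) (rule finite_subset[OF _ fin], blast)
    with min[OF wA] show False by simp
  qed
  with z y have "covered_by L z y"
    by (simp add: covered_by_def)
  with z show ?thesis using that by blast
qed

text \<open>The order dual of the preceding lemma, read off from
  \<open>inv_gorder L\<close>.\<close>

lemma ex_covered_by_lower:
  fixes L :: "'b gorder" (structure)
  assumes "partial_order L" and lf: "locally_finite L" and x: "x \<in> carrier L" and y: "y \<in> carrier L" and less: "x \<sqsubset> y"
  obtains z where "z \<sqsubseteq> y" "covered_by L x z"
proof -
  interpret partial_order L by fact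
  interpret dual: partial_order "inv_gorder L" by (rule dual_order)
  have less_dual: "u \<sqsubset>\<^bsub>inv_gorder L\<^esub> v \<longleftrightarrow> v \<sqsubset> u" for u v
    by (auto simp: dual.lless_eq lless_eq)
  have "locally_finite (inv_gorder L)"
    using lf by (auto simp: locally_finite_def at_least_at_most_def conj_commute)
  moreover have "y \<sqsubset>\<^bsub>inv_gorder L\<^esub> x"
    using less by (simp add: less_dual)
  ultimately obtain z where "y \<sqsubseteq>\<^bsub>inv_gorder L\<^esub> z" "covered_by (inv_gorder L) z x"
    using ex_covered_by_upper[OF dual.partial_order_axioms, of y x] x y by auto
  then show ?thesis
    using that[of z] by (auto simp: covered_by_def less_dual)
qed

section \<open>The tolerance on the index lattice\<close>

context modular_connected_system
begin

sublocale S: lattice S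
  by (rule lattice_S)

abbreviation tle (infix \<open>\<unlhd>\<close> 50) where
  "x \<unlhd> y \<equiv> tol_le S \<gamma> x y"

abbreviation rel where
  "rel \<equiv> mcs_rel S \<gamma> L F \<phi>"

abbreviation proj where
  "proj \<equiv> mcs_proj S \<gamma> L F \<phi>"

definition supp :: "('s \<times> 'a) set \<Rightarrow> 's set" where
  "supp c = {x \<in> carrier S. c \<in> mcs_block S \<gamma> L F \<phi> x}"

lemma tol_carrier:
  assumes "(x, y) \<in> \<gamma>"
  shows "x \<in> carrier S" "y \<in> carrier S"
  using assms tolerance_S by (auto simp: tolerance_def)

lemma tol_refl: "x \<in> carrier S \<Longrightarrow> (x, x) \<in> \<gamma>"
  using tolerance_S by (auto simp: tolerance_def refl_on_def)

lemma tol_sym: "(x, y) \<in> \<gamma> \<Longrightarrow> (y, x) \<in> \<gamma>"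
  using tolerance_S by (auto simp: tolerance_def elim: symE)

lemma tol_join: "(a, b) \<in> \<gamma> \<Longrightarrow> (c, d) \<in> \<gamma> \<Longrightarrow> (a \<squnion>\<^bsub>S\<^esub> c, b \<squnion>\<^bsub>S\<^esub> d) \<in> \<gamma>"
  using tolerance_S unfolding tolerance_def by blast

lemma tol_meet: "(a, b) \<in> \<gamma> \<Longrightarrow> (c, d) \<in> \<gamma> \<Longrightarrow> (a \<sqinter>\<^bsub>S\<^esub> c, b \<sqinter>\<^bsub>S\<^esub> d) \<in> \<gamma>"
  using tolerance_S unfolding tolerance_def by blast

lemma join_absorb:
  assumes "x \<in> carrier S" "y \<in> carrier S" "x \<sqsubseteq>\<^bsub>S\<^esub> y"
  shows "x \<squnion>\<^bsub>S\<^esub> y = y" "y \<squnion>\<^bsub>S\<^esub> x = y"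
  using assms S.le_iff_meet join_comm by metis+

lemma meet_absorb:
  assumes "x \<in> carrier S" "y \<in> carrier S" "x \<sqsubseteq>\<^bsub>S\<^esub> y"
  shows "x \<sqinter>\<^bsub>S\<^esub> y = x" "y \<sqinter>\<^bsub>S\<^esub> x = x"
  using assms S.le_iff_join meet_comm by metis+

lemma tle_le: "x \<unlhd> y \<Longrightarrow> x \<sqsubseteq>\<^bsub>S\<^esub> y"
  and tle_tol: "x \<unlhd> y \<Longrightarrow> (x, y) \<in> \<gamma>"
  by (simp_all add: tol_le_def)

lemma tle_carrier:
  assumes "x \<unlhd> y"
  shows "x \<in> carrier S" "y \<in> carrier S"
  using assms tol_carrier by (auto simp: tol_le_def)

lemma tle_refl: "x \<in> carrier S \<Longrightarrow> x \<unlhd> x"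
  by (simp add: tol_le_def tol_refl)

lemma tle_join: "(x, y) \<in> \<gamma> \<Longrightarrow> x \<unlhd> x \<squnion>\<^bsub>S\<^esub> y"
  using tol_join[of x x x y] tol_carrier[of x y] tol_refl[of x]
  by (simp add: tol_le_def S.join_left join_absorb)

lemma tle_meet: "(x, y) \<in> \<gamma> \<Longrightarrow> x \<sqinter>\<^bsub>S\<^esub> y \<unlhd> x"
  using tol_meet[of x x y x] tol_carrier[of x y] tol_refl[of x] tol_sym[of x y]
  by (simp add: tol_le_def S.meet_left meet_absorb)

text \<open>The meet is \<gamma>-related to \<open>x\<close> and to \<open>y\<close>; joining these
  two relations leaves the meet on the left and gives the join on the right.\<close>

lemma tol_meet_join:
  assumes "(x, y) \<in> \<gamma>"
  shows "x \<sqinter>\<^bsub>S\<^esub> y \<unlhd> x \<squnion>\<^bsub>S\<^esub> y"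
proof -
  have car: "x \<in> carrier S" "y \<in> carrier S" using assms by (rule tol_carrier)+
  have "(x \<sqinter>\<^bsub>S\<^esub> y, x) \<in> \<gamma>" "(x \<sqinter>\<^bsub>S\<^esub> y, y) \<in> \<gamma>"
    using assms tle_meet[of x y] tle_meet[of y x] tol_sym[of x y] meet_comm[of S x y]
    by (auto simp: tol_le_def)
  from tol_join[OF this] have "(x \<sqinter>\<^bsub>S\<^esub> y, x \<squnion>\<^bsub>S\<^esub> y) \<in> \<gamma>"
    using car by (simp add: join_absorb)
  moreover have "x \<sqinter>\<^bsub>S\<^esub> y \<sqsubseteq>\<^bsub>S\<^esub> x \<squnion>\<^bsub>S\<^esub> y"
    using S.le_trans[OF S.meet_left S.join_left] car by simp
  ultimately show ?thesis by (simp add: tol_le_def)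
qed

text \<open>Meeting \<open>x \<gamma> y\<close> with \<open>z \<gamma> z\<close> gives
  \<open>x \<gamma> z\<close>; joining them gives \<open>z \<gamma> y\<close>.\<close>

lemma tle_between:
  assumes "x \<unlhd> y" "z \<in> carrier S" "x \<sqsubseteq>\<^bsub>S\<^esub> z" "z \<sqsubseteq>\<^bsub>S\<^esub> y"
  shows "x \<unlhd> z" "z \<unlhd> y"
proof -
  have car: "x \<in> carrier S" "y \<in> carrier S" using assms(1) by (rule tle_carrier)+
  have tol: "(x, y) \<in> \<gamma>" "(z, z) \<in> \<gamma>"
    using assms tol_refl by (auto simp: tol_le_def)
  show "x \<unlhd> z"
    using tol_meet[OF tol] assms car by (simp add: tol_le_def meet_absorb)
  show "z \<unlhd> y"
    using tol_join[OF tol] assms car by (simp add: tol_le_def join_absorb)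
qed

section \<open>Blocks and their connecting maps\<close>

lemma bounded_lattice_L: "x \<in> carrier S \<Longrightarrow> bounded_lattice (L x)"
  using MC2 by (simp add: complemented_lattice_def)

lemma finite_L: "x \<in> carrier S \<Longrightarrow> finite (carrier (L x))"
  using MC2 by blast

lemma bot_closed: "x \<in> carrier S \<Longrightarrow> \<bottom>\<^bsub>L x\<^esub> \<in> carrier (L x)"
  and bot_least: "x \<in> carrier S \<Longrightarrow> a \<in> carrier (L x) \<Longrightarrow> \<bottom>\<^bsub>L x\<^esub> \<sqsubseteq>\<^bsub>L x\<^esub> a"
  and top_closed: "x \<in> carrier S \<Longrightarrow> \<top>\<^bsub>L x\<^esub> \<in> carrier (L x)"
  and top_greatest: "x \<in> carrier S \<Longrightarrow> a \<in> carrier (L x) \<Longrightarrow> a \<sqsubseteq>\<^bsub>L x\<^esub> \<top>\<^bsub>L x\<^esub>"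
proof -
  assume "x \<in> carrier S"
  then interpret L: bounded_lattice "L x" by (rule bounded_lattice_L)
  show "\<bottom>\<^bsub>L x\<^esub> \<in> carrier (L x)" "\<top>\<^bsub>L x\<^esub> \<in> carrier (L x)" by simp_all
  show "\<bottom>\<^bsub>L x\<^esub> \<sqsubseteq>\<^bsub>L x\<^esub> a" "a \<sqsubseteq>\<^bsub>L x\<^esub> \<top>\<^bsub>L x\<^esub>" if "a \<in> carrier (L x)"
    using that by simp_all
qed

lemma
  assumes "x \<unlhd> y"
  shows F_closed: "F x y \<subseteq> carrier (L x)"
    and I_closed: "I x y \<subseteq> carrier (L y)"
    and F_nonempty: "F x y \<noteq> {}"
    and phi_bij: "bij_betw (\<phi> x y) (F x y) (I x y)"
  using MC3[OF assms] by (auto simp: lattice_filter_def lattice_ideal_def lattice_iso_on_def)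

lemma F_up: "x \<unlhd> y \<Longrightarrow> a \<in> F x y \<Longrightarrow> b \<in> carrier (L x) \<Longrightarrow> a \<sqsubseteq>\<^bsub>L x\<^esub> b \<Longrightarrow> b \<in> F x y"
  using MC3 unfolding lattice_filter_def by blast

lemma I_down: "x \<unlhd> y \<Longrightarrow> a \<in> I x y \<Longrightarrow> b \<in> carrier (L y) \<Longrightarrow> b \<sqsubseteq>\<^bsub>L y\<^esub> a \<Longrightarrow> b \<in> I x y"
  using MC3 unfolding lattice_ideal_def by blast

lemma phi_mem: "x \<unlhd> y \<Longrightarrow> a \<in> F x y \<Longrightarrow> \<phi> x y a \<in> I x y"
  using phi_bij by (auto simp: bij_betw_def)

lemma phi_inj: "x \<unlhd> y \<Longrightarrow> a \<in> F x y \<Longrightarrow> b \<in> F x y \<Longrightarrow> \<phi> x y a = \<phi> x y b \<Longrightarrow> a = b"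
  using phi_bij by (auto simp: bij_betw_def dest: inj_onD)

lemma phi_surj: "x \<unlhd> y \<Longrightarrow> b \<in> I x y \<Longrightarrow> \<exists>a\<in>F x y. b = \<phi> x y a"
  using phi_bij[of x y] by (auto simp: bij_betw_def)

lemma
  assumes "x \<unlhd> y" "z \<in> carrier S" "x \<sqsubseteq>\<^bsub>S\<^esub> z" "z \<sqsubseteq>\<^bsub>S\<^esub> y"
  shows F_between: "a \<in> F x y \<longleftrightarrow> a \<in> F x z \<and> \<phi> x z a \<in> F z y"
    and I_between: "I x y = \<phi> z y ` (I x z \<inter> F z y)"
    and phi_between: "a \<in> F x y \<Longrightarrow> \<phi> x y a = \<phi> z y (\<phi> x z a)"
proof -
  have *: "F x y = {a \<in> F x z. \<phi> x z a \<in> I x z \<inter> F z y} \<and>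
        I x y = \<phi> z y ` (I x z \<inter> F z y) \<and> (\<forall>a\<in>F x y. \<phi> x y a = \<phi> z y (\<phi> x z a))"
    using MC6[of z x y] assms tle_tol by blast
  show "a \<in> F x y \<longleftrightarrow> a \<in> F x z \<and> \<phi> x z a \<in> F z y"
    using * phi_mem[OF tle_between(1)[OF assms]] by blast
  show "I x y = \<phi> z y ` (I x z \<inter> F z y)" "a \<in> F x y \<Longrightarrow> \<phi> x y a = \<phi> z y (\<phi> x z a)"
    using * by auto
qed

section \<open>The equivalence relation behind the sum\<close>

text \<open>Any common \<open>\<gamma>\<close>-upper bound \<open>w\<close>, not just the join, may be used to identify two points.\<close>
lemma rel_iff:
  "((x, a), (y, b)) \<in> rel \<longleftrightarrow>
     (\<exists>w. x \<unlhd> w \<and> y \<unlhd> w \<and> a \<in> F x w \<and> b \<in> F y w \<and> \<phi> x w a = \<phi> y w b)"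
proof
  assume "((x, a), (y, b)) \<in> rel"
  then have r: "(x, y) \<in> \<gamma>" "a \<in> F x (x \<squnion>\<^bsub>S\<^esub> y)" "b \<in> F y (x \<squnion>\<^bsub>S\<^esub> y)"
      "\<phi> x (x \<squnion>\<^bsub>S\<^esub> y) a = \<phi> y (x \<squnion>\<^bsub>S\<^esub> y) b"
    by (auto simp: mcs_rel_def)
  moreover have "x \<unlhd> x \<squnion>\<^bsub>S\<^esub> y" "y \<unlhd> x \<squnion>\<^bsub>S\<^esub> y"
    using tle_join[OF r(1)] tle_join[OF tol_sym[OF r(1)]] by (simp_all add: join_comm[of S])
  ultimately show "\<exists>w. x \<unlhd> w \<and> y \<unlhd> w \<and> a \<in> F x w \<and> b \<in> F y w \<and> \<phi> x w a = \<phi> y w b"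
    by blast
next
  assume "\<exists>w. x \<unlhd> w \<and> y \<unlhd> w \<and> a \<in> F x w \<and> b \<in> F y w \<and> \<phi> x w a = \<phi> y w b"
  then obtain w where w: "x \<unlhd> w" "y \<unlhd> w" "a \<in> F x w" "b \<in> F y w" "\<phi> x w a = \<phi> y w b"
    by blast
  have car: "x \<in> carrier S" "y \<in> carrier S" "w \<in> carrier S"
    using w tle_carrier by auto
  have ab: "a \<in> carrier (L x)" "b \<in> carrier (L y)"
    using w F_closed by blast+
  \<comment> \<open>Meet of \<open>x \<gamma> w\<close> with \<open>w \<gamma> y\<close>.\<close>
  have tol: "(x, y) \<in> \<gamma>"
    using tol_meet[OF tle_tol[OF w(1)] tol_sym[OF tle_tol[OF w(2)]]] car w tle_le
    by (simp add: meet_absorb)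
  define j where "j = x \<squnion>\<^bsub>S\<^esub> y"
  have j: "j \<in> carrier S" "x \<sqsubseteq>\<^bsub>S\<^esub> j" "y \<sqsubseteq>\<^bsub>S\<^esub> j" "j \<sqsubseteq>\<^bsub>S\<^esub> w"
    using car w tle_le by (auto simp: j_def S.join_left S.join_right S.join_le)
  have a: "a \<in> F x j" "\<phi> x j a \<in> F j w" "\<phi> x w a = \<phi> j w (\<phi> x j a)"
    using F_between[OF w(1) j(1,2,4)] phi_between[OF w(1) j(1,2,4)] w(3) by auto
  have b: "b \<in> F y j" "\<phi> y j b \<in> F j w" "\<phi> y w b = \<phi> j w (\<phi> y j b)"
    using F_between[OF w(2) j(1,3,4)] phi_between[OF w(2) j(1,3,4)] w(4) by auto
  \<comment> \<open>Both maps into \<open>w\<close> factor through the join \<open>j\<close>, and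
    \<open>\<phi> j w\<close> is injective, so equality in \<open>w\<close> already holds in
    \<open>j\<close>.\<close>
  have "\<phi> x j a = \<phi> y j b"
    using phi_inj[OF tle_between(2)[OF w(1) j(1,2,4)] a(2) b(2)] a(3) b(3) w(5) by simp
  then show "((x, a), (y, b)) \<in> rel"
    using car ab tol a(1) b(1) by (simp add: mcs_rel_def mcs_points_def j_def)
qed

text \<open>If \<open>b\<close> survives in both \<open>p\<close> and \<open>q\<close>, it survives in their join: this is (MC7) followed by (MC5).\<close>
lemma F_join:
  assumes p: "y \<unlhd> p" and q: "y \<unlhd> q" and b: "b \<in> F y p" "b \<in> F y q"
  shows "y \<unlhd> p \<squnion>\<^bsub>S\<^esub> q" "b \<in> F y (p \<squnion>\<^bsub>S\<^esub> q)"
proof -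
  define m where "m = p \<sqinter>\<^bsub>S\<^esub> q"
  define j where "j = p \<squnion>\<^bsub>S\<^esub> q"
  have car: "y \<in> carrier S" "p \<in> carrier S" "q \<in> carrier S"
    using p q tle_carrier by auto
  have le: "y \<sqsubseteq>\<^bsub>S\<^esub> p" "y \<sqsubseteq>\<^bsub>S\<^esub> q" using p q tle_le by auto
  \<comment> \<open>Join of \<open>p \<gamma> y\<close> with \<open>y \<gamma> q\<close>.\<close>
  have tol: "(p, q) \<in> \<gamma>"
    using tol_join[OF tol_sym[OF tle_tol[OF p]] tle_tol[OF q]] car le
    by (simp add: join_absorb)
  have m: "m \<in> carrier S" "y \<sqsubseteq>\<^bsub>S\<^esub> m" "m \<sqsubseteq>\<^bsub>S\<^esub> p" "m \<sqsubseteq>\<^bsub>S\<^esub> q"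
    using car le by (auto simp: m_def S.meet_left S.meet_right S.meet_le)
  have mj: "m \<unlhd> j" unfolding m_def j_def by (rule tol_meet_join[OF tol])
  \<comment> \<open>Pass to the meet \<open>m\<close>: there the image of \<open>b\<close> lies in
    the filters towards both \<open>p\<close> and \<open>q\<close>, as the filter half of (MC7)
    requires.\<close>
  have b': "b \<in> F y m" "\<phi> y m b \<in> F m p" "\<phi> y m b \<in> F m q"
    using b F_between[OF p m(1,2,3)] F_between[OF q m(1,2,4)] by auto
  then have b'': "\<phi> y m b \<in> F m j"
    using MC7[OF tol] by (auto simp: m_def j_def)
  have ym: "y \<unlhd> m" by (rule tle_between(1)[OF p m(1,2,3)])
  have "(y, j) \<in> \<gamma>"
    using MC5[OF ym mj] phi_mem[OF ym b'(1)] b'' by blast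
  moreover have "y \<sqsubseteq>\<^bsub>S\<^esub> j"
    using S.le_trans[OF m(2) tle_le[OF mj]] car m(1) by (simp add: j_def)
  ultimately have yj: "y \<unlhd> j" by (simp add: tol_le_def)
  then show "y \<unlhd> p \<squnion>\<^bsub>S\<^esub> q" by (simp add: j_def)
  show "b \<in> F y (p \<squnion>\<^bsub>S\<^esub> q)"
    using F_between[OF yj m(1,2) tle_le[OF mj]] b'(1) b'' by (simp add: j_def)
qed

text \<open>In \<open>p\<close> the elements \<open>a\<close> and \<open>b\<close> have the same
  image, and since \<open>b\<close> survives up to \<open>w\<close>, this image lies in
  \<open>F p w\<close>. Then (MC5) relates \<open>x\<close> to \<open>w\<close>, and (MC6) carries
  the equality from \<open>p\<close> up to \<open>w\<close>.\<close>

lemma F_transport: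
  assumes xp: "x \<unlhd> p" and yp: "y \<unlhd> p" and yw: "y \<unlhd> w" and pw: "p \<sqsubseteq>\<^bsub>S\<^esub> w"
    and a: "a \<in> F x p" and b: "b \<in> F y p" "b \<in> F y w" and eq: "\<phi> x p a = \<phi> y p b"
  shows "x \<unlhd> w" "a \<in> F x w" "\<phi> x w a = \<phi> y w b"
proof -
  have car: "x \<in> carrier S" "p \<in> carrier S" "w \<in> carrier S"
    using xp yw tle_carrier by auto
  have "\<phi> y p b \<in> F p w"
    using F_between[OF yw car(2) tle_le[OF yp] pw] b by simp
  then have ap: "\<phi> x p a \<in> F p w" by (simp add: eq)
  have "p \<unlhd> w" by (rule tle_between(2)[OF yw car(2) tle_le[OF yp] pw])
  then have "(x, w) \<in> \<gamma>"
    using MC5[OF xp] phi_mem[OF xp a] ap by blast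
  moreover have "x \<sqsubseteq>\<^bsub>S\<^esub> w"
    using S.le_trans[OF tle_le[OF xp] pw] car by simp
  ultimately show xw: "x \<unlhd> w" by (simp add: tol_le_def)
  show aw: "a \<in> F x w"
    using F_between[OF xw car(2) tle_le[OF xp] pw] a ap by simp
  show "\<phi> x w a = \<phi> y w b"
    using phi_between[OF xw car(2) tle_le[OF xp] pw aw]
      phi_between[OF yw car(2) tle_le[OF yp] pw b(2)] eq by simp
qed

text \<open>The middle element \<open>b\<close> survives in the join \<open>w\<close> of the two
  witnesses by \<open>F_join\<close>; \<open>F_transport\<close> then brings \<open>a\<close> and
  \<open>c\<close> to \<open>w\<close>, where both have the image of \<open>b\<close>.\<close>

lemma rel_trans:
  assumes "((x, a), (y, b)) \<in> rel" "((y, b), (z, c)) \<in> rel"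
  shows "((x, a), (z, c)) \<in> rel"
proof -
  obtain p where p: "x \<unlhd> p" "y \<unlhd> p" "a \<in> F x p" "b \<in> F y p" "\<phi> x p a = \<phi> y p b"
    using assms(1) rel_iff by blast
  obtain q where q: "y \<unlhd> q" "z \<unlhd> q" "b \<in> F y q" "c \<in> F z q" "\<phi> y q b = \<phi> z q c"
    using assms(2) rel_iff by blast
  define w where "w = p \<squnion>\<^bsub>S\<^esub> q"
  have w: "p \<sqsubseteq>\<^bsub>S\<^esub> w" "q \<sqsubseteq>\<^bsub>S\<^esub> w"
    using p(1) q(1) tle_carrier by (auto simp: w_def S.join_left S.join_right)
  have yw: "y \<unlhd> w" "b \<in> F y w"
    using F_join[OF p(2) q(1) p(4) q(3)] by (simp_all add: w_def)
  have "x \<unlhd> w" "a \<in> F x w" "\<phi> x w a = \<phi> y w b"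
    using F_transport[OF p(1,2) yw(1) w(1) p(3,4) yw(2) p(5)] by auto
  moreover have "z \<unlhd> w" "c \<in> F z w" "\<phi> z w c = \<phi> y w b"
    using F_transport[OF q(2,1) yw(1) w(2) q(4,3) yw(2) q(5)[symmetric]] by auto
  ultimately show ?thesis unfolding rel_iff by auto
qed

lemma equiv_rel: "equiv (mcs_points S L) rel"
proof (rule equivI)
  show "rel \<subseteq> mcs_points S L \<times> mcs_points S L"
    by (auto simp: mcs_rel_def)
  show "refl_on (mcs_points S L) rel"
    using tle_refl MC4 by (fastforce simp: refl_on_def mcs_points_def rel_iff)
  show "sym rel"
    by (rule symI) (metis rel_iff surj_pair)
  show "trans rel"
    using rel_trans by (auto intro!: transI)
qed

lemma proj_eq_iff:
  assumes "x \<in> carrier S" "a \<in> carrier (L x)" "y \<in> carrier S" "b \<in> carrier (L y)"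
  shows "proj x a = proj y b \<longleftrightarrow> ((x, a), (y, b)) \<in> rel"
  using assms unfolding mcs_proj_def
  by (intro eq_equiv_class_iff[OF equiv_rel]) (auto simp: mcs_points_def)

lemma proj_phi:
  assumes "x \<unlhd> y" "a \<in> F x y"
  shows "proj y (\<phi> x y a) = proj x a"
proof -
  have car: "x \<in> carrier S" "y \<in> carrier S" using assms(1) by (rule tle_carrier)+
  have a: "a \<in> carrier (L x)" and b: "\<phi> x y a \<in> carrier (L y)"
    using assms F_closed I_closed phi_mem by blast+
  \<comment> \<open>The witness is \<open>y\<close> itself, where \<open>\<phi> y y\<close> is the
    identity by (MC4).\<close>
  have "((y, \<phi> x y a), (x, a)) \<in> rel"
    unfolding rel_iff using assms tle_refl car(2) MC4[OF car(2)] b by force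
  then show ?thesis using proj_eq_iff[OF car(2) b car(1) a] by simp
qed

section \<open>Supports along the order of the sum\<close>

lemma supp_tol:
  assumes "x \<in> supp c" "y \<in> supp c"
  shows "(x, y) \<in> \<gamma>"
proof -
  obtain a b where ab: "x \<in> carrier S" "a \<in> carrier (L x)" "c = proj x a"
      "y \<in> carrier S" "b \<in> carrier (L y)" "c = proj y b"
    using assms by (auto simp: supp_def mcs_block_def)
  then have "((x, a), (y, b)) \<in> rel"
    using proj_eq_iff[of x a y b] by simp
  then show ?thesis by (simp add: mcs_rel_def)
qed

text \<open>The preimages picked by \<open>inv_into\<close> serve as representatives; they project
  back to \<open>a\<close> and \<open>b\<close> because both lie in the block.\<close>

lemma block_leE:
  assumes "mcs_block_le S \<gamma> L F \<phi> v a b"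
  obtains \<alpha> \<beta> where "\<alpha> \<in> carrier (L v)" "\<beta> \<in> carrier (L v)" "a = proj v \<alpha>" "b = proj v \<beta>"
    "\<alpha> \<sqsubseteq>\<^bsub>L v\<^esub> \<beta>"
proof
  show "inv_into (carrier (L v)) (proj v) a \<in> carrier (L v)"
    "inv_into (carrier (L v)) (proj v) b \<in> carrier (L v)"
    "a = proj v (inv_into (carrier (L v)) (proj v) a)"
    "b = proj v (inv_into (carrier (L v)) (proj v) b)"
    "inv_into (carrier (L v)) (proj v) a \<sqsubseteq>\<^bsub>L v\<^esub> inv_into (carrier (L v)) (proj v) b"
    using assms by (auto simp: mcs_block_le_def mcs_block_def inv_into_into f_inv_into_f)
qed

lemma supp_meet_of_block_le:
  assumes v: "v \<in> carrier S" and le: "mcs_block_le S \<gamma> L F \<phi> v a b" and z: "z \<in> supp b"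
  shows "v \<sqinter>\<^bsub>S\<^esub> z \<in> supp a"
proof -
  obtain \<alpha> \<beta> where ab: "\<alpha> \<in> carrier (L v)" "\<beta> \<in> carrier (L v)" "a = proj v \<alpha>" "b = proj v \<beta>"
      "\<alpha> \<sqsubseteq>\<^bsub>L v\<^esub> \<beta>"
    using le by (rule block_leE)
  obtain \<delta> where \<delta>: "z \<in> carrier S" "\<delta> \<in> carrier (L z)" "b = proj z \<delta>"
    using z by (auto simp: supp_def mcs_block_def)
  have "((v, \<beta>), (z, \<delta>)) \<in> rel"
    using proj_eq_iff[OF v ab(2) \<delta>(1,2)] ab(4) \<delta>(3) by simp
  then have r: "(v, z) \<in> \<gamma>" "\<beta> \<in> F v (v \<squnion>\<^bsub>S\<^esub> z)" "\<delta> \<in> F z (v \<squnion>\<^bsub>S\<^esub> z)"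
      "\<phi> v (v \<squnion>\<^bsub>S\<^esub> z) \<beta> = \<phi> z (v \<squnion>\<^bsub>S\<^esub> z) \<delta>"
    by (auto simp: mcs_rel_def)
  define m where "m = v \<sqinter>\<^bsub>S\<^esub> z"
  define j where "j = v \<squnion>\<^bsub>S\<^esub> z"
  have vj: "v \<unlhd> j" and zj: "z \<unlhd> j"
    using tle_join[OF r(1)] tle_join[OF tol_sym[OF r(1)]] by (simp_all add: j_def join_comm[of S])
  have mv: "m \<unlhd> v" and mj: "m \<unlhd> j"
    unfolding m_def j_def using r(1) by (auto intro: tle_meet tol_meet_join)
  \<comment> \<open>The common image of \<open>\<beta>\<close> and \<open>\<delta>\<close> lies in
    both ideals of \<open>L j\<close>, which is the input of the ideal half of (MC7).\<close>
  have "\<phi> v j \<beta> \<in> I v j \<inter> I z j"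
    using phi_mem[OF vj] phi_mem[OF zj] r by (metis IntI j_def)
  then have "\<phi> v j \<beta> \<in> I m j"
    using MC7[OF r(1)] by (auto simp: m_def j_def)
  then obtain \<beta>' where "\<beta>' \<in> I m v" "\<beta>' \<in> F v j" "\<phi> v j \<beta> = \<phi> v j \<beta>'"
    using I_between[OF mj v tle_le[OF mv] tle_le[OF vj]] by auto
  \<comment> \<open>(MC6) writes the image of \<open>\<beta>\<close> as that of some
    \<open>\<beta>'\<close> in \<open>I m v\<close>, and injectivity of \<open>\<phi> v j\<close>
    identifies the two. The ideal then contains \<open>\<alpha>\<close> as well, so
    \<open>\<alpha>\<close> comes from the block at \<open>m\<close>.\<close>
  then have "\<beta> \<in> I m v"
    using phi_inj[OF vj, of \<beta> \<beta>'] r(2) by (simp add: j_def)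
  then have "\<alpha> \<in> I m v"
    using I_down[OF mv] ab by blast
  then obtain \<alpha>' where \<alpha>': "\<alpha>' \<in> F m v" "\<alpha> = \<phi> m v \<alpha>'"
    using phi_surj[OF mv] by blast
  then have "a = proj m \<alpha>'"
    using proj_phi[OF mv] ab(3) by simp
  moreover have "\<alpha>' \<in> carrier (L m)" using \<alpha>' F_closed[OF mv] by blast
  ultimately have "m \<in> supp a"
    using tle_carrier[OF mv] by (auto simp: supp_def mcs_block_def)
  then show ?thesis by (simp add: m_def)
qed

text \<open>The relation of \<open>\<alpha>\<close> to its representative at \<open>z\<close> places
  \<open>\<alpha>\<close> in the filter of \<open>L v\<close> towards the join. Upward closure adds
  \<open>\<beta>\<close>, whose image represents \<open>b\<close> in the block at the join.\<close>

lemma supp_join_of_block_le: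
  assumes v: "v \<in> carrier S" and le: "mcs_block_le S \<gamma> L F \<phi> v a b" and z: "z \<in> supp a"
  shows "v \<squnion>\<^bsub>S\<^esub> z \<in> supp b"
proof -
  obtain \<alpha> \<beta> where ab: "\<alpha> \<in> carrier (L v)" "\<beta> \<in> carrier (L v)" "a = proj v \<alpha>" "b = proj v \<beta>"
      "\<alpha> \<sqsubseteq>\<^bsub>L v\<^esub> \<beta>"
    using le by (rule block_leE)
  obtain \<delta> where \<delta>: "z \<in> carrier S" "\<delta> \<in> carrier (L z)" "a = proj z \<delta>"
    using z by (auto simp: supp_def mcs_block_def)
  have "((v, \<alpha>), (z, \<delta>)) \<in> rel"
    using proj_eq_iff[OF v ab(1) \<delta>(1,2)] ab(3) \<delta>(3) by simp
  then have r: "(v, z) \<in> \<gamma>" "\<alpha> \<in> F v (v \<squnion>\<^bsub>S\<^esub> z)"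
    by (auto simp: mcs_rel_def)
  have vj: "v \<unlhd> v \<squnion>\<^bsub>S\<^esub> z" by (rule tle_join[OF r(1)])
  have \<beta>: "\<beta> \<in> F v (v \<squnion>\<^bsub>S\<^esub> z)"
    using F_up[OF vj r(2)] ab by blast
  then have "b = proj (v \<squnion>\<^bsub>S\<^esub> z) (\<phi> v (v \<squnion>\<^bsub>S\<^esub> z) \<beta>)"
    using proj_phi[OF vj] ab(4) by simp
  moreover have "\<phi> v (v \<squnion>\<^bsub>S\<^esub> z) \<beta> \<in> carrier (L (v \<squnion>\<^bsub>S\<^esub> z))"
    using phi_mem[OF vj \<beta>] I_closed[OF vj] by blast
  ultimately show ?thesis
    using tle_carrier[OF vj] by (auto simp: supp_def mcs_block_def)
qed

lemma mcs_le_induct [consumes 1, case_names refl step]: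
  assumes "mcs_le S \<gamma> L F \<phi> a b"
    and "P a"
    and "\<And>v c d. P c \<Longrightarrow> v \<in> carrier S \<Longrightarrow> mcs_block_le S \<gamma> L F \<phi> v c d \<Longrightarrow> P d"
  shows "P b"
proof -
  show ?thesis
    using assms(1) unfolding mcs_le_def
  proof (elim exE conjE)
    fix n :: nat and x c
    assume c: "c 0 = a" "c n = b" "\<forall>i\<in>{1..n}. x i \<in> carrier S"
      "\<forall>i\<in>{1..n}. mcs_block_le S \<gamma> L F \<phi> (x i) (c (i - 1)) (c i)"
    have "i \<le> n \<Longrightarrow> P (c i)" for i
    proof (induction i)
      case 0
      then show ?case using assms(2) c(1) by simp
    next
      case (Suc i)
      then show ?case
        \<comment> \<open>Step \<open>Suc i\<close> of the chain leads from \<open>c i\<close> to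
          \<open>c (Suc i)\<close> inside the block at \<open>x (Suc i)\<close>.\<close>
        using c(3,4) assms(3)[of "c i" "x (Suc i)" "c (Suc i)"] by force
    qed
    then show "P b" using c(2) by blast
  qed
qed

lemma supp_subset: "supp c \<subseteq> carrier S"
  by (auto simp: supp_def)

lemma supp_below:
  assumes "mcs_le S \<gamma> L F \<phi> a b" "z \<in> supp b"
  shows "\<exists>x\<in>supp a. x \<sqsubseteq>\<^bsub>S\<^esub> z"
proof -
  \<comment> \<open>Quantified over all \<open>z\<close>, since the induction climbs the chain while
    the index descends: \<open>z\<close> at \<open>d\<close> is replaced by its meet with
    \<open>v\<close> at \<open>c\<close>.\<close>
  from assms(1) have "\<forall>z\<in>supp b. \<exists>x\<in>supp a. x \<sqsubseteq>\<^bsub>S\<^esub> z"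
  proof (induction rule: mcs_le_induct)
    case refl
    then show ?case using supp_subset by blast
  next
    case (step v c d)
    show ?case
    proof
      fix z
      assume z: "z \<in> supp d"
      then have m: "v \<sqinter>\<^bsub>S\<^esub> z \<in> supp c"
        using step supp_meet_of_block_le by blast
      then obtain x where x: "x \<in> supp a" "x \<sqsubseteq>\<^bsub>S\<^esub> v \<sqinter>\<^bsub>S\<^esub> z"
        using step by blast
      have car: "x \<in> carrier S" "v \<sqinter>\<^bsub>S\<^esub> z \<in> carrier S" "z \<in> carrier S"
        using x m z supp_subset by auto
      have "x \<sqsubseteq>\<^bsub>S\<^esub> z"
        using S.le_trans[OF x(2) S.meet_right] car step(2) by simp
      then show "\<exists>x\<in>supp a. x \<sqsubseteq>\<^bsub>S\<^esub> z" using x by blast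
    qed
  qed
  then show ?thesis using assms(2) by blast
qed

text \<open>Here index and chain climb together: \<open>z\<close> stays fixed at \<open>a\<close>,
  and the index above it is joined with \<open>v\<close> at each step.\<close>

lemma supp_above:
  assumes "mcs_le S \<gamma> L F \<phi> a b" "z \<in> supp a"
  shows "\<exists>y\<in>supp b. z \<sqsubseteq>\<^bsub>S\<^esub> y"
  using assms(1)
proof (induction rule: mcs_le_induct)
  case refl
  then show ?case using assms(2) supp_subset by blast
next
  case (step v c d)
  then obtain y where y: "y \<in> supp c" "z \<sqsubseteq>\<^bsub>S\<^esub> y" by blast
  then have j: "v \<squnion>\<^bsub>S\<^esub> y \<in> supp d"
    using step supp_join_of_block_le by blast
  have car: "z \<in> carrier S" "v \<squnion>\<^bsub>S\<^esub> y \<in> carrier S" "y \<in> carrier S"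
    using assms(2) j y supp_subset by auto
  have "z \<sqsubseteq>\<^bsub>S\<^esub> v \<squnion>\<^bsub>S\<^esub> y"
    using S.le_trans[OF y(2) S.join_right] car step(2) by simp
  then show ?case using j by blast
qed

section \<open>Finiteness of supports\<close>

text \<open>The bottom of \<open>L z\<close> lies in the nonempty ideal \<open>I x z\<close> but not
  in \<open>F z y\<close>: a filter containing it is the whole block, against (MC8.2). Its preimage
  in \<open>F x z\<close> is therefore missing from \<open>F x y\<close>.\<close>

lemma F_psubset:
  assumes xy: "x \<unlhd> y" and xz: "x \<sqsubseteq>\<^bsub>S\<^esub> z" and cov: "covered_by S z y"
  shows "F x y \<subset> F x z"
proof -
  have z: "z \<in> carrier S" "z \<sqsubseteq>\<^bsub>S\<^esub> y"
    using cov by (auto simp: covered_by_def S.lless_eq)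
  have xz': "x \<unlhd> z" and zy: "z \<unlhd> y" using tle_between[OF xy z(1) xz z(2)] by auto
  obtain a where a: "a \<in> F x z" using F_nonempty[OF xz'] by blast
  then have "\<bottom>\<^bsub>L z\<^esub> \<in> I x z"
    using I_down[OF xz' phi_mem[OF xz' a] bot_closed[OF z(1)]] bot_least[OF z(1)]
      phi_mem[OF xz' a] I_closed[OF xz'] by blast
  then obtain c where c: "c \<in> F x z" "\<bottom>\<^bsub>L z\<^esub> = \<phi> x z c"
    using phi_surj[OF xz'] by blast
  have "\<bottom>\<^bsub>L z\<^esub> \<notin> F z y"
    using MC8_2[OF cov] F_up[OF zy] bot_least[OF z(1)] F_closed[OF zy] by blast
  then have "c \<notin> F x y"
    using F_between[OF xy z(1) xz z(2)] c(2) by simp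
  then show ?thesis
    using c(1) F_between[OF xy z(1) xz z(2)] by blast
qed

text \<open>Dually, the top of \<open>L z\<close> lies in \<open>F z y\<close> but not in the proper
  ideal \<open>I x z\<close>; as \<open>\<phi> z y\<close> is injective, its image separates
  \<open>I z y\<close> from \<open>I x y\<close>.\<close>

lemma I_psubset:
  assumes xy: "x \<unlhd> y" and zy: "z \<sqsubseteq>\<^bsub>S\<^esub> y" and cov: "covered_by S x z"
  shows "I x y \<subset> I z y"
proof -
  have z: "z \<in> carrier S" "x \<sqsubseteq>\<^bsub>S\<^esub> z"
    using cov by (auto simp: covered_by_def S.lless_eq)
  have xz: "x \<unlhd> z" and zy': "z \<unlhd> y" using tle_between[OF xy z(1,2) zy] by auto
  note eq = I_between[OF xy z(1,2) zy]
  have top: "\<top>\<^bsub>L z\<^esub> \<in> F z y"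
    using F_nonempty[OF zy'] F_closed[OF zy'] F_up[OF zy'] top_closed[OF z(1)]
      top_greatest[OF z(1)] by blast
  have "\<top>\<^bsub>L z\<^esub> \<notin> I x z"
    using MC8_2[OF cov] I_down[OF xz] top_greatest[OF z(1)] I_closed[OF xz] by blast
  then have "\<phi> z y \<top>\<^bsub>L z\<^esub> \<notin> I x y"
    using phi_inj[OF zy' top] unfolding eq by blast
  moreover have "\<phi> z y \<top>\<^bsub>L z\<^esub> \<in> I z y" by (rule phi_mem[OF zy' top])
  moreover have "I x y \<subseteq> I z y"
    unfolding eq using phi_mem[OF zy'] by blast
  ultimately show ?thesis by blast
qed

lemma locally_finite_S: "locally_finite S"
  using MC1 by (simp add: lffc_def)

text \<open>Descent on \<open>card (F x y)\<close>: below each \<open>y\<close> other than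
  \<open>x\<close> sits a lower cover \<open>z\<close> above \<open>x\<close> with a larger filter,
  and \<open>z\<close> has finitely many upper covers.\<close>

lemma finite_tle_above:
  assumes x: "x \<in> carrier S"
  shows "finite {y. x \<unlhd> y}"
proof (rule finite_by_descent[where x = x and f = "\<lambda>y. card (F x y)"
        and C = "\<lambda>z. {y. covered_by S z y}" and N = "card (carrier (L x))"])
  fix y
  assume y: "y \<in> {y. x \<unlhd> y}" "y \<noteq> x"
  then have xy: "x \<unlhd> y" by simp
  then have "x \<sqsubset>\<^bsub>S\<^esub> y" using y(2) tle_le by (auto simp: S.lless_eq)
  then obtain z where z: "x \<sqsubseteq>\<^bsub>S\<^esub> z" "covered_by S z y"
    using ex_covered_by_upper[OF S.partial_order_axioms locally_finite_S x] tle_carrier[OF xy] by blast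
  then have xz: "x \<unlhd> z"
    using tle_between(1)[OF xy] by (simp add: covered_by_def S.lless_eq)
  have "card (F x y) < card (F x z)"
    using F_psubset[OF xy z] finite_subset[OF F_closed[OF xz] finite_L[OF x]]
    by (simp add: psubset_card_mono)
  then show "\<exists>z\<in>{y. x \<unlhd> y}. y \<in> {y. covered_by S z y} \<and> card (F x y) < card (F x z)"
    using z xz by blast
next
  show "finite {y. covered_by S z y}" if "z \<in> {y. x \<unlhd> y}" for z
    using that MC1 tle_carrier by (simp add: lffc_def)
  show "card (F x y) \<le> card (carrier (L x))" if "y \<in> {y. x \<unlhd> y}" for y
    using that F_closed finite_L[OF x] by (simp add: card_mono)
qed

text \<open>The dual descent, on \<open>card (I x y)\<close> and through upper covers of
  \<open>x\<close> that stay below \<open>y\<close>.\<close>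

lemma finite_tle_below:
  assumes y: "y \<in> carrier S"
  shows "finite {x. x \<unlhd> y}"
proof (rule finite_by_descent[where x = y and f = "\<lambda>x. card (I x y)"
        and C = "\<lambda>z. {x. covered_by S x z}" and N = "card (carrier (L y))"])
  fix x
  assume x: "x \<in> {x. x \<unlhd> y}" "x \<noteq> y"
  then have xy: "x \<unlhd> y" by simp
  then have "x \<sqsubset>\<^bsub>S\<^esub> y" using x(2) tle_le by (auto simp: S.lless_eq)
  then obtain z where z: "z \<sqsubseteq>\<^bsub>S\<^esub> y" "covered_by S x z"
    using ex_covered_by_lower[OF S.partial_order_axioms locally_finite_S _ y] tle_carrier[OF xy] by blast
  then have zy: "z \<unlhd> y"
    using tle_between(2)[OF xy] by (simp add: covered_by_def S.lless_eq)
  have "card (I x y) < card (I z y)"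
    using I_psubset[OF xy z] finite_subset[OF I_closed[OF zy] finite_L[OF y]]
    by (simp add: psubset_card_mono)
  then show "\<exists>z\<in>{x. x \<unlhd> y}. x \<in> {x. covered_by S x z} \<and> card (I x y) < card (I z y)"
    using z zy by blast
next
  show "finite {x. covered_by S x z}" if "z \<in> {x. x \<unlhd> y}" for z
    using that MC1 tle_carrier by (simp add: lffc_def)
  show "card (I x y) \<le> card (carrier (L y))" if "x \<in> {x. x \<unlhd> y}" for x
    using that I_closed finite_L[OF y] by (simp add: card_mono)
qed

lemma finite_supp: "finite (supp c)"
proof (cases "supp c = {}")
  case False
  then obtain x where x: "x \<in> supp c" by blast
  \<comment> \<open>Any \<open>y\<close> in the support shares with the fixed \<open>x\<close> the
    \<gamma>-upper bound given by their join; only finitely many \<open>w\<close> lie above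
    \<open>x\<close>, and finitely many \<open>y\<close> below each \<open>w\<close>.\<close>
  have "supp c \<subseteq> (\<Union>w\<in>{w. x \<unlhd> w}. {y. y \<unlhd> w})"
  proof
    fix y
    assume "y \<in> supp c"
    then have "(x, y) \<in> \<gamma>" using supp_tol x by blast
    then have "x \<unlhd> x \<squnion>\<^bsub>S\<^esub> y" "y \<unlhd> x \<squnion>\<^bsub>S\<^esub> y"
      using tle_join[of x y] tle_join[of y x] tol_sym by (simp_all add: join_comm[of S])
    then show "y \<in> (\<Union>w\<in>{w. x \<unlhd> w}. {y. y \<unlhd> w})" by blast
  qed
  moreover have "finite (\<Union>w\<in>{w. x \<unlhd> w}. {y. y \<unlhd> w})"
    using finite_tle_above finite_tle_below tle_carrier x supp_subset by blast
  ultimately show ?thesis by (rule finite_subset)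
qed simp

section \<open>Intervals of the sum\<close>

lemma supp_nonempty:
  assumes "c \<in> mcs_points S L // rel"
  shows "supp c \<noteq> {}"
proof -
  obtain x a where "x \<in> carrier S" "a \<in> carrier (L x)" "c = proj x a"
    using assms by (auto simp: quotient_def mcs_points_def mcs_proj_def)
  then show ?thesis by (auto simp: supp_def mcs_block_def)
qed

theorem locally_finite_sum: "locally_finite (mcs_sum S \<gamma> L F \<phi>)"
  unfolding locally_finite_def
proof (intro ballI)
  fix a b
  let ?Z = "\<Union>x\<in>supp a. \<Union>y\<in>supp b. \<lbrace>x..y\<rbrace>\<^bsub>S\<^esub>"
  have "finite \<lbrace>x..y\<rbrace>\<^bsub>S\<^esub>" if "x \<in> supp a" "y \<in> supp b" for x y
    using that locally_finite_S supp_subset unfolding locally_finite_def by blast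
  then have "finite ?Z"
    using finite_supp by blast
  moreover have "finite (mcs_block S \<gamma> L F \<phi> z)" if "z \<in> ?Z" for z
    using that finite_L by (auto simp: mcs_block_def at_least_at_most_def)
  ultimately have "finite (\<Union>z\<in>?Z. mcs_block S \<gamma> L F \<phi> z)" by blast
  moreover have "\<lbrace>a..b\<rbrace>\<^bsub>mcs_sum S \<gamma> L F \<phi>\<^esub> \<subseteq> (\<Union>z\<in>?Z. mcs_block S \<gamma> L F \<phi> z)"
  proof
    fix c
    assume "c \<in> \<lbrace>a..b\<rbrace>\<^bsub>mcs_sum S \<gamma> L F \<phi>\<^esub>"
    then have c: "c \<in> mcs_points S L // rel" "mcs_le S \<gamma> L F \<phi> a c" "mcs_le S \<gamma> L F \<phi> c b"
      by (auto simp: at_least_at_most_def mcs_sum_def)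
    \<comment> \<open>A single index of \<open>c\<close> is enough, since the aim is one block
      through \<open>c\<close> with index in \<open>?Z\<close>.\<close>
    obtain z where z: "z \<in> supp c" using supp_nonempty[OF c(1)] by blast
    obtain x y where "x \<in> supp a" "x \<sqsubseteq>\<^bsub>S\<^esub> z" "y \<in> supp b" "z \<sqsubseteq>\<^bsub>S\<^esub> y"
      using supp_below[OF c(2) z] supp_above[OF c(3) z] by blast
    then have "z \<in> ?Z"
      using z supp_subset by (auto simp: at_least_at_most_def)
    moreover have "c \<in> mcs_block S \<gamma> L F \<phi> z" using z by (simp add: supp_def)
    ultimately show "c \<in> (\<Union>z\<in>?Z. mcs_block S \<gamma> L F \<phi> z)" by blast
  qed
  ultimately show "finite \<lbrace>a..b\<rbrace>\<^bsub>mcs_sum S \<gamma> L F \<phi>\<^esub>"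
    by (rule finite_subset[rotated])
qed

end

theorem theorem4p46:
  fixes S :: "'s gorder"
    and \<gamma> :: "('s \<times> 's) set"
    and L :: "'s \<Rightarrow> 'a gorder"
    and F I :: "'s \<Rightarrow> 's \<Rightarrow> 'a set"
    and \<phi> :: "'s \<Rightarrow> 's \<Rightarrow> 'a \<Rightarrow> 'a"
  assumes "modular_connected_system S \<gamma> L F I \<phi>"
  shows "locally_finite (mcs_sum S \<gamma> L F \<phi>)"
  using assms by (rule modular_connected_system.locally_finite_sum)

end
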